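(* Let $L,L'$ be two generic distinct lines in $\mathbb{P}^3$. There is a generic choice of a finite set of points $X\subseteq L$ for which it is possible a generic choice of a finite set of points $X'\subseteq L'$ (each set with at least two points) such that: (1) $X\star X'=(X\star L')\cap(X'\star L)$ and $|X\star X'|=|X||X'|$; (2) $L\star L'$ is an irreducible and non-degenerate quadric, and $X\star L'$ and $X'\star L$ are lines of the two different rulings.
   Context: Work over an algebraically closed field $\mathbb{K}$. For points $P=[p_0:\dots:p_3]$, $Q=[q_0:\dots:q_3]$ of $\mathbb{P}^3$, the Hadamard product is $P\star Q=[p_0q_0:\dots:p_3q_3]$, defined when not all $p_iq_i$ vanish. For projective varieties $X,Y\subseteq\mathbb{P}^3$, $X\star Y$ is the closure of the set of all defined products $P\star Q$ with $P\in X$, $Q\in Y$; in particular, for a finite set $X$ and a line $L'$, $X\star L'=\bigcup_{P\in X}P\star L'$. A non-degenerate quadric is a smooth quadric surface in $\mathbb{P}^3$; it carries two rulings, i.e. two families of lines. In (2), the rulings are those of the quadric $L\star L'$: the $P\star L'$ with $P\in X$ are lines of one ruling and the $P'\star L$ with $P'\in X'$ are lines of the other. *)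

theory Defs
  imports "HOL-Analysis.Analysis" "HOL-Computational_Algebra.Polynomial"
begin

section \<open>Points and lines of projective 3-space\<close>

definition proj_rel :: "('a::field)^4 \<Rightarrow> 'a^4 \<Rightarrow> bool" where
  "proj_rel v w \<longleftrightarrow> v \<noteq> 0 \<and> w \<noteq> 0 \<and> (\<exists>c. c \<noteq> 0 \<and> w = c *s v)"

quotient_type (overloaded) 'a p3 = "('a::field)^4" / partial: proj_rel
  morphisms rep_pt pt
proof (rule part_equivpI)
  have "(axis 1 1 :: 'a^4) \<noteq> 0"
    by (simp add: axis_eq_0_iff)
  then have "proj_rel (axis 1 1 :: 'a^4) (axis 1 1)"
    unfolding proj_rel_def by (intro conjI exI[of _ 1]) auto
  then show "\<exists>v :: 'a^4. proj_rel v v"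
    by blast
  show "symp (proj_rel :: 'a^4 \<Rightarrow> 'a^4 \<Rightarrow> bool)"
  proof (rule sympI)
    fix v w :: "'a^4"
    assume "proj_rel v w"
    then obtain c where c: "v \<noteq> 0" "w \<noteq> 0" "c \<noteq> 0" "w = c *s v"
      unfolding proj_rel_def by blast
    then have "v = inverse c *s w"
      by (simp add: vector_smult_assoc)
    with c show "proj_rel w v"
      unfolding proj_rel_def using nonzero_imp_inverse_nonzero by blast
  qed
  show "transp (proj_rel :: 'a^4 \<Rightarrow> 'a^4 \<Rightarrow> bool)"
  proof (rule transpI)
    fix u v w :: "'a^4"
    assume "proj_rel u v" "proj_rel v w"
    then obtain c d where "u \<noteq> 0" "w \<noteq> 0" "c \<noteq> 0" "d \<noteq> 0" "w = (d * c) *s u"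
      unfolding proj_rel_def by (auto simp: vector_smult_assoc)
    then show "proj_rel u w"
      unfolding proj_rel_def using no_zero_divisors by blast
  qed
qed

text \<open>The term \<open>pt v\<close> denotes the point with homogeneous coordinates \<open>v\<close>; it is meaningful only
  for \<open>v \<noteq> 0\<close>, and every use below carries this guard.\<close>

definition is_line :: "('a::field) p3 set \<Rightarrow> bool" where
  "is_line L \<longleftrightarrow> (\<exists>W. vec.subspace W \<and> vec.dim W = 2 \<and> L = pt ` (W - {0}))"


section \<open>Zariski topologies and genericity\<close>

text \<open>Polynomial functions in the variables \<open>V\<close>. Over an infinite field (in particular over an
  algebraically closed one) these are the same as polynomials.\<close>

inductive poly_fun :: "'v set \<Rightarrow> (('v \<Rightarrow> 'a::comm_ring_1) \<Rightarrow> 'a) \<Rightarrow> bool" for V :: "'v set" where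
  const: "poly_fun V (\<lambda>x. c)"
| var: "i \<in> V \<Longrightarrow> poly_fun V (\<lambda>x. x i)"
| add: "poly_fun V f \<Longrightarrow> poly_fun V g \<Longrightarrow> poly_fun V (\<lambda>x. f x + g x)"
| mult: "poly_fun V f \<Longrightarrow> poly_fun V g \<Longrightarrow> poly_fun V (\<lambda>x. f x * g x)"

text \<open>Here \<open>C p\<close> is the set of all choices of (multi-)homogeneous coordinates of \<open>p\<close>, and a
  polynomial vanishes at \<open>p\<close> when it vanishes on every such choice. Over an infinite field this
  happens iff all its (multi-)homogeneous components vanish at \<open>p\<close>, so these are exactly the
  zero loci of families of (multi-)homogeneous polynomials.\<close>

definition zariski_closed :: "'v set \<Rightarrow> ('p \<Rightarrow> ('v \<Rightarrow> 'a::comm_ring_1) set) \<Rightarrow> 'p set \<Rightarrow> bool" where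
  "zariski_closed V C Z \<longleftrightarrow>
     (\<exists>F. (\<forall>f\<in>F. poly_fun V f) \<and> Z = {p. \<forall>f\<in>F. \<forall>x\<in>C p. f x = 0})"

text \<open>\<open>P\<close> holds on a nonempty relatively open subset of \<open>T\<close>. This is used only for irreducible
  parameter spaces \<open>T\<close>, where such a subset is dense.\<close>

definition generically ::
  "'v set \<Rightarrow> ('p \<Rightarrow> ('v \<Rightarrow> 'a::comm_ring_1) set) \<Rightarrow> 'p set \<Rightarrow> ('p \<Rightarrow> bool) \<Rightarrow> bool" where
  "generically V C T P \<longleftrightarrow>
     (\<exists>Z. zariski_closed V C Z \<and> \<not> T \<subseteq> Z \<and> (\<forall>p\<in>T - Z. P p))"

definition point_coords :: "('a::field) p3 \<Rightarrow> (4 \<Rightarrow> 'a) set" where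
  "point_coords P = {($) v | v. v \<noteq> 0 \<and> pt v = P}"

abbreviation closed_p3 :: "('a::field) p3 set \<Rightarrow> bool" where
  "closed_p3 \<equiv> zariski_closed UNIV point_coords"

definition irreducible_p3 :: "('a::field) p3 set \<Rightarrow> bool" where
  "irreducible_p3 Q \<longleftrightarrow> Q \<noteq> {} \<and>
     (\<forall>A B. closed_p3 A \<longrightarrow> closed_p3 B \<longrightarrow> Q \<subseteq> A \<union> B \<longrightarrow> Q \<subseteq> A \<or> Q \<subseteq> B)"

text \<open>A list of \<open>n\<close> points is a point of the \<open>n\<close>-fold product of projective 3-space; the variable
  \<open>(i, k)\<close> is the \<open>k\<close>-th coordinate of the \<open>i\<close>-th point.\<close>

definition tuple_coords :: "('a::field) p3 list \<Rightarrow> (nat \<times> 4 \<Rightarrow> 'a) set" where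
  "tuple_coords xs = {x. \<forall>i<length xs. (\<lambda>k. x (i, k)) \<in> point_coords (xs ! i)}"

text \<open>A generic set of \<open>n\<close> points of \<open>L\<close> is the underlying set of a generic \<open>n\<close>-tuple of pairwise
  distinct points of \<open>L\<close>.\<close>

definition generic_points :: "nat \<Rightarrow> ('a::field) p3 set \<Rightarrow> ('a p3 set \<Rightarrow> bool) \<Rightarrow> bool" where
  "generic_points n L P \<longleftrightarrow>
     generically ({..<n} \<times> UNIV) tuple_coords
       {xs. length xs = n \<and> distinct xs \<and> set xs \<subseteq> L} (\<lambda>xs. P (set xs))"

text \<open>Lines are parametrized by the Grassmannian in its Pluecker embedding. All 16 entries of the
  antisymmetric matrix of Pluecker coordinates are used; different bases \<open>a, b\<close> yield nonzero
  multiples of the same matrix.\<close>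

definition pluecker_coords :: "('a::field) p3 set \<Rightarrow> (4 \<times> 4 \<Rightarrow> 'a) set" where
  "pluecker_coords L = {(\<lambda>(i, j). a $ i * b $ j - a $ j * b $ i) | a b.
     a \<noteq> b \<and> vec.independent {a, b} \<and> L = pt ` (vec.span {a, b} - {0})}"

definition line_pair_coords ::
  "('a::field) p3 set \<times> 'a p3 set \<Rightarrow> ((4 \<times> 4) + (4 \<times> 4) \<Rightarrow> 'a) set" where
  "line_pair_coords = (\<lambda>(L, L'). {case_sum p q | p q. p \<in> pluecker_coords L \<and> q \<in> pluecker_coords L'})"

definition generic_distinct_lines :: "(('a::field) p3 set \<Rightarrow> 'a p3 set \<Rightarrow> bool) \<Rightarrow> bool" where
  "generic_distinct_lines P \<longleftrightarrow>
     generically UNIV line_pair_coords {(L, L'). is_line L \<and> is_line L' \<and> L \<noteq> L'} (\<lambda>(L, L'). P L L')"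


section \<open>Hadamard products\<close>

text \<open>Multiplication on \<open>'a^4\<close> is coordinatewise.\<close>

definition hadamard :: "('a::field) p3 set \<Rightarrow> 'a p3 set \<Rightarrow> 'a p3 set"  (infixl \<open>\<star>\<close> 75) where
  "X \<star> Y = closed_p3 hull
     {pt (p * q) | p q. p \<noteq> 0 \<and> q \<noteq> 0 \<and> pt p \<in> X \<and> pt q \<in> Y \<and> p * q \<noteq> 0}"


section \<open>Quadrics and their rulings\<close>

definition quad_form :: "('a::field)^4^4 \<Rightarrow> 'a^4 \<Rightarrow> 'a" where
  "quad_form A x = (\<Sum>i\<in>UNIV. \<Sum>j\<in>UNIV. A $ i $ j * x $ i * x $ j)"

text \<open>\<open>A\<close> need not be symmetric, so that every quadratic form is covered also in characteristic 2.\<close>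

definition quadric_of :: "('a::field)^4^4 \<Rightarrow> 'a p3 set \<Rightarrow> bool" where
  "quadric_of A Q \<longleftrightarrow> (\<exists>x. quad_form A x \<noteq> 0) \<and> Q = {pt x | x. x \<noteq> 0 \<and> quad_form A x = 0}"

text \<open>Smoothness is the Jacobian criterion: the sum below is the partial derivative of the form in
  the \<open>k\<close>-th variable.\<close>

definition nondegenerate_quadric :: "('a::field) p3 set \<Rightarrow> bool" where
  "nondegenerate_quadric Q \<longleftrightarrow> (\<exists>A. quadric_of A Q \<and>
     (\<forall>x. x \<noteq> 0 \<longrightarrow> quad_form A x = 0 \<longrightarrow>
        (\<exists>k. (\<Sum>i\<in>UNIV. (A $ k $ i + A $ i $ k) * x $ i) \<noteq> 0)))"

definition rulings :: "('a::field) p3 set \<Rightarrow> 'a p3 set set \<Rightarrow> 'a p3 set set \<Rightarrow> bool" where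
  "rulings Q R S \<longleftrightarrow>
     R \<union> S = {l. is_line l \<and> l \<subseteq> Q} \<and> R \<inter> S = {} \<and>
     (\<forall>P\<in>Q. (\<exists>!l. l \<in> R \<and> P \<in> l) \<and> (\<exists>!m. m \<in> S \<and> P \<in> m)) \<and>
     (\<forall>l\<in>R. \<forall>l'\<in>R. l \<noteq> l' \<longrightarrow> l \<inter> l' = {}) \<and>
     (\<forall>m\<in>S. \<forall>m'\<in>S. m \<noteq> m' \<longrightarrow> m \<inter> m' = {}) \<and>
     (\<forall>l\<in>R. \<forall>m\<in>S. \<exists>!P. P \<in> l \<inter> m)"

end

theory Submission
  imports Defs
begin

text \<open>
  Let \<open>L\<close> and \<open>L'\<close> be the projectivizations of the planes spanned by \<open>a, b\<close> and by \<open>c, d\<close>. The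
  coordinatewise product is bilinear:
  \<open>(s a + t b) (u c + v d) = su (a c) + sv (a d) + tu (b c) + tv (b d)\<close>.
  If the four products \<open>a c, a d, b c, b d\<close> are linearly independent (the locale \<open>segre_frame\<close>),
  then they form a coordinate frame of projective 3-space in which the product map
  \<open>L \<times> L' \<rightarrow> P\<^sup>3\<close> is literally the Segre embedding. Everything is then classical: the map is
  injective (\<open>hmul_inject\<close>), its image is the smooth quadric \<open>z\<^sub>1 z\<^sub>4 = z\<^sub>2 z\<^sub>3\<close>
  (\<open>quadric_eq_products\<close>, \<open>nondegenerate\<close>, \<open>irreducible\<close>), and the lines on this quadric are the
  images of \<open>{P} \<times> L'\<close> and of \<open>L \<times> {Q}\<close>, which form the two rulings (\<open>lines_in_quadric\<close>,
  \<open>rulings_quadric\<close>). The grid identity and the cardinality count hold because an injective map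
  commutes with the intersection \<open>(X \<times> L') \<inter> (L \<times> X') = X \<times> X'\<close>; this works for all finite sets
  \<open>X\<close> and \<open>X'\<close>, so that genericity of the points amounts to the existence of enough points on a
  line (\<open>generic_points_all\<close>).

  Genericity of the lines comes from the determinant of the four products. Up to sign it is the
  polynomial \<open>p\<^sub>1\<^sub>2 p\<^sub>3\<^sub>4 q\<^sub>1\<^sub>3 q\<^sub>2\<^sub>4 - p\<^sub>1\<^sub>3 p\<^sub>2\<^sub>4 q\<^sub>1\<^sub>2 q\<^sub>3\<^sub>4\<close> in the Pluecker coordinates \<open>p\<close>, \<open>q\<close> of the two
  lines, which compares the cross ratios of the four points in which each line meets the
  coordinate planes. It does not vanish identically on pairs of distinct lines
  (\<open>exists_segre_lines\<close>), so its nonvanishing is a nonempty open condition.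

  Hadamard products are closures; hence the sets of products of points have to be shown closed.
  In frame coordinates they are given by explicit equations.
\<close>

section \<open>Points and their coordinates\<close>

lemma proj_rel_refl: "v \<noteq> 0 \<Longrightarrow> proj_rel v v"
  unfolding proj_rel_def by (intro conjI exI[of _ 1]) auto

lemma pt_eq_iff:
  assumes "v \<noteq> 0" "w \<noteq> 0"
  shows "pt v = pt w \<longleftrightarrow> (\<exists>k. k \<noteq> 0 \<and> w = k *s v)"
proof -
  have "pt v = pt w \<longleftrightarrow> proj_rel v w"
    using Quotient3_rel[OF Quotient3_p3, of v w] proj_rel_refl[OF assms(1)] proj_rel_refl[OF assms(2)]
    by simp
  with assms show ?thesis by (simp add: proj_rel_def)
qed

lemma rep_pt_nonzero: "rep_pt P \<noteq> 0"
  using Quotient3_rep_reflp[OF Quotient3_p3, of P] unfolding proj_rel_def by blast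

lemma pt_rep_pt: "pt (rep_pt P) = P"
  by (rule Quotient3_abs_rep[OF Quotient3_p3])

lemma pt_cases: obtains v where "v \<noteq> 0" "P = pt v"
  using that[of "rep_pt P"] by (simp add: rep_pt_nonzero pt_rep_pt)

lemma pt_scale:
  assumes "v \<noteq> 0" "k \<noteq> 0" shows "pt (k *s v) = pt v"
proof -
  have "k *s v \<noteq> 0" using assms by (simp add: vector_mul_eq_0)
  then show ?thesis using pt_eq_iff[of v "k *s v"] assms by metis
qed

lemma scale_times_scale: "(k *s p) * (l *s q) = (k * l) *s (p * q)" for p q :: "('a::field)^'n"
  by (simp add: vec_eq_iff)

lemma span_pair: "x \<in> vec.span {p, q} \<longleftrightarrow> (\<exists>s t. x = s *s p + t *s q)"
proof -
  have "x \<in> vec.span {p, q} \<longleftrightarrow> (\<exists>s t. x - s *s p = t *s q)"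
    by (simp add: vec.span_breakdown_eq vec.span_singleton image_iff)
  also have "\<dots> \<longleftrightarrow> (\<exists>s t. x = s *s p + t *s q)"
    by (simp add: diff_eq_eq add.commute)
  finally show ?thesis .
qed

lemma independent_pair:
  fixes x y :: "('a::field)^'n"
  assumes "\<And>s t. s *s x + t *s y = 0 \<Longrightarrow> s = 0 \<and> t = 0"
  shows "x \<noteq> y" "vec.independent {x, y}"
proof -
  have y: "y \<noteq> 0" using assms[of 0 1] by auto
  have x: "x \<notin> vec.span {y}"
  proof
    assume "x \<in> vec.span {y}"
    then obtain k where "x = k *s y" by (auto simp: vec.span_singleton)
    then show False using assms[of 1 "-k"] by auto
  qed
  then show "x \<noteq> y" by (auto simp: vec.span_base)
  then show "vec.independent {x, y}"
    using x y by (simp add: vec.independent_insert)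
qed

lemma dim_span_pair:
  fixes x y :: "('a::field)^'n"
  assumes "\<And>s t. s *s x + t *s y = 0 \<Longrightarrow> s = 0 \<and> t = 0"
  shows "vec.dim (vec.span {x, y}) = 2"
proof -
  have "x \<noteq> y" "vec.independent {x, y}" using assms by (rule independent_pair; blast)+
  then show ?thesis by (simp add: vec.dim_eq_card_independent)
qed

section \<open>Closed sets\<close>

lemma poly_fun_sum: "finite I \<Longrightarrow> (\<And>i. i \<in> I \<Longrightarrow> poly_fun V (f i)) \<Longrightarrow> poly_fun V (\<lambda>x. \<Sum>i\<in>I. f i x)"
proof (induction I rule: finite_induct)
  case empty
  show ?case by (simp add: poly_fun.const)
next
  case (insert i I)
  then show ?case by (simp add: poly_fun.add)
qed

lemma poly_fun_diff:
  assumes "poly_fun V f" "poly_fun V g" shows "poly_fun V (\<lambda>x. f x - g x)"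
  using poly_fun.add[OF assms(1) poly_fun.mult[OF poly_fun.const[of V "-1"] assms(2)]] by simp

text \<open>This reduces statements on nonvanishing of polynomial functions to the fact that a nonzero
  polynomial in one variable has finitely many roots.\<close>

lemma poly_fun_along_curve:
  fixes f :: "('v \<Rightarrow> 'a::comm_ring_1) \<Rightarrow> 'a"
  assumes "poly_fun V f" "\<And>i. \<exists>h. \<forall>r. \<gamma> r i = poly h r"
  shows "\<exists>h. \<forall>r. f (\<gamma> r) = poly h r"
  using assms(1)
proof induction
  case (const c)
  show ?case by (intro exI[of _ "[:c:]"]) simp
next
  case (var i)
  show ?case by (rule assms(2))
next
  case (add f g)
  then obtain h k where "\<forall>r. f (\<gamma> r) = poly h r" "\<forall>r. g (\<gamma> r) = poly k r" by blast
  then show ?case by (intro exI[of _ "h + k"]) simp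
next
  case (mult f g)
  then obtain h k where "\<forall>r. f (\<gamma> r) = poly h r" "\<forall>r. g (\<gamma> r) = poly k r" by blast
  then show ?case by (intro exI[of _ "h * k"]) simp
qed

text \<open>Equations whose simultaneous vanishing does not depend on the choice of a coordinate vector.
  General families in the definition of a closed set need not have this property, and for them
  pairwise products do not obviously describe the union of two closed sets: two different
  coordinate vectors of the same point may be involved. Here they do (\<open>cut_out_Un\<close>).\<close>

definition cut_out :: "(((4 \<Rightarrow> 'a::field) \<Rightarrow> 'a) set) \<Rightarrow> 'a p3 set \<Rightarrow> bool" where
  "cut_out F S \<longleftrightarrow> (\<forall>f\<in>F. poly_fun UNIV f) \<and>
     (\<forall>v. v \<noteq> 0 \<longrightarrow> (pt v \<in> S \<longleftrightarrow> (\<forall>f\<in>F. f (($) v) = 0)))"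

lemma cut_out_closed: "cut_out F S \<Longrightarrow> closed_p3 S"
  unfolding zariski_closed_def point_coords_def
proof (intro exI conjI)
  assume F: "cut_out F S"
  show "\<forall>f\<in>F. poly_fun UNIV f" using F by (simp add: cut_out_def)
  show "S = {p. \<forall>f\<in>F. \<forall>x\<in>{($) v |v. v \<noteq> 0 \<and> pt v = p}. f x = 0}"
  proof (intro set_eqI)
    fix P :: "'a p3"
    obtain v where v: "v \<noteq> 0" "P = pt v" by (rule pt_cases)
    have "P \<in> S \<longleftrightarrow> (\<forall>f\<in>F. f (($) w) = 0)" if "w \<noteq> 0" "pt w = P" for w
      using F that unfolding cut_out_def by blast
    with v show "P \<in> S \<longleftrightarrow> P \<in> {p. \<forall>f\<in>F. \<forall>x\<in>{($) v |v. v \<noteq> 0 \<and> pt v = p}. f x = 0}"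
      by blast
  qed
qed

lemma cut_out_Un:
  assumes "cut_out F S" "cut_out G T"
  shows "cut_out (\<Union>f\<in>F. \<Union>g\<in>G. {\<lambda>x. f x * g x}) (S \<union> T)"
  unfolding cut_out_def
proof (intro conjI allI impI)
  show "\<forall>h\<in>(\<Union>f\<in>F. \<Union>g\<in>G. {\<lambda>x. f x * g x}). poly_fun UNIV h"
  proof
    fix h assume "h \<in> (\<Union>f\<in>F. \<Union>g\<in>G. {\<lambda>x. f x * g x})"
    then obtain f g where "h = (\<lambda>x. f x * g x)" "f \<in> F" "g \<in> G" by blast
    with assms show "poly_fun UNIV h" by (simp add: cut_out_def poly_fun.mult)
  qed
  fix v :: "'a^4" assume "v \<noteq> 0"
  then have "pt v \<in> S \<union> T \<longleftrightarrow> (\<forall>f\<in>F. f (($) v) = 0) \<or> (\<forall>g\<in>G. g (($) v) = 0)"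
    using assms by (simp add: cut_out_def)
  also have "\<dots> \<longleftrightarrow> (\<forall>f\<in>F. \<forall>g\<in>G. f (($) v) * g (($) v) = 0)"
    unfolding mult_eq_0_iff by blast
  also have "\<dots> \<longleftrightarrow> (\<forall>h\<in>(\<Union>f\<in>F. \<Union>g\<in>G. {\<lambda>x. f x * g x}). h (($) v) = 0)"
    by simp
  finally show "pt v \<in> S \<union> T \<longleftrightarrow> (\<forall>h\<in>(\<Union>f\<in>F. \<Union>g\<in>G. {\<lambda>x. f x * g x}). h (($) v) = 0)" .
qed

lemma cut_out_empty: "cut_out {\<lambda>x. 1} {}"
  by (simp add: cut_out_def poly_fun.const)

lemma closed_finite_Union:
  assumes "finite I" "\<And>i. i \<in> I \<Longrightarrow> \<exists>F. cut_out F (S i)"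
  shows "closed_p3 (\<Union>i\<in>I. S i)"
proof -
  have "\<exists>F. cut_out F (\<Union>i\<in>I. S i)"
    using assms
  proof (induction I rule: finite_induct)
    case empty
    then show ?case using cut_out_empty by auto
  next
    case (insert i I)
    obtain F where "cut_out F (S i)" using insert.prems by blast
    moreover obtain G where "cut_out G (\<Union>i\<in>I. S i)" using insert.IH insert.prems by auto
    ultimately have "cut_out (\<Union>f\<in>F. \<Union>g\<in>G. {\<lambda>x. f x * g x}) (S i \<union> (\<Union>i\<in>I. S i))"
      by (rule cut_out_Un)
    then show ?case unfolding UN_insert by blast
  qed
  then show ?thesis using cut_out_closed by blast
qed

text \<open>The equations of the point \<open>[v]\<close> are the \<open>2 \<times> 2\<close> minors of the matrix with the rows \<open>x\<close> and
  \<open>v\<close>.\<close>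

lemma cut_out_point: "\<exists>F. cut_out F {P}"
proof (cases P rule: pt_cases)
  case (1 v)
  let ?F = "(\<Union>i. \<Union>j. {\<lambda>x. x i * v $ j - x j * v $ i})"
  have "cut_out ?F {P}"
    unfolding cut_out_def
  proof (intro conjI allI impI)
    show "\<forall>f\<in>?F. poly_fun UNIV f"
    proof
      fix f assume "f \<in> ?F"
      then obtain i j where f: "f = (\<lambda>x. x i * v $ j - x j * v $ i)" by blast
      show "poly_fun UNIV f"
        unfolding f by (intro poly_fun_diff poly_fun.mult poly_fun.var poly_fun.const UNIV_I)
    qed
    fix w :: "'a^4" assume w: "w \<noteq> 0"
    obtain j where j: "v $ j \<noteq> 0" using 1(1) by (auto simp: vec_eq_iff)
    have "pt w \<in> {P} \<longleftrightarrow> (\<exists>k. k \<noteq> 0 \<and> w = k *s v)"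
      using pt_eq_iff[OF 1(1) w] 1(2) by (simp add: eq_commute)
    also have "\<dots> \<longleftrightarrow> (\<forall>i j. w $ i * v $ j - w $ j * v $ i = 0)"
    proof
      assume *: "\<forall>i j. w $ i * v $ j - w $ j * v $ i = 0"
      have "w $ i = (w $ j / v $ j) * v $ i" for i
        using *[rule_format, of i j] j by (simp add: field_simps)
      then have "w = (w $ j / v $ j) *s v"
        unfolding vec_eq_iff vector_smult_component by blast
      moreover have "w $ j / v $ j \<noteq> 0" using calculation w by auto
      ultimately show "\<exists>k. k \<noteq> 0 \<and> w = k *s v" by blast
    qed (auto simp: ac_simps)
    also have "\<dots> \<longleftrightarrow> (\<forall>f\<in>?F. f (($) w) = 0)" by simp
    finally show "pt w \<in> {P} \<longleftrightarrow> (\<forall>f\<in>?F. f (($) w) = 0)" .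
  qed
  then show ?thesis by blast
qed

lemma closed_finite: "finite S \<Longrightarrow> closed_p3 S"
  using closed_finite_Union[of S "\<lambda>P. {P}"] cut_out_point by auto

section \<open>Products of points\<close>

text \<open>A total function on points, which is the Hadamard product wherever that is defined. In this
  form the set-level statements become statements about images of an injective map.\<close>

definition hmul :: "('a::field) p3 \<Rightarrow> 'a p3 \<Rightarrow> 'a p3" where
  "hmul P Q = pt (rep_pt P * rep_pt Q)"

lemma hmul_pt:
  assumes "p \<noteq> 0" "q \<noteq> 0" "p * q \<noteq> 0"
  shows "hmul (pt p) (pt q) = pt (p * q)"
proof -
  have "\<exists>k. k \<noteq> 0 \<and> rep_pt (pt p) = k *s p" if "p \<noteq> 0" for p :: "'a^4"
    using pt_eq_iff[OF that rep_pt_nonzero[of "pt p"]] by (simp add: pt_rep_pt)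
  then obtain k l where "k \<noteq> 0" "rep_pt (pt p) = k *s p" "l \<noteq> 0" "rep_pt (pt q) = l *s q"
    using assms by metis
  then show ?thesis
    using assms(3) by (simp add: hmul_def scale_times_scale pt_scale)
qed

lemma hmul_commute: "hmul P Q = hmul Q P"
  by (simp add: hmul_def mult.commute)

definition proj :: "(('a::field)^4) set \<Rightarrow> 'a p3 set" where
  "proj W = pt ` (W - {0})"

lemma proj_cases:
  assumes "P \<in> proj W" obtains p where "p \<in> W" "p \<noteq> 0" "P = pt p"
  using assms unfolding proj_def by blast

lemma pt_in_projI: "p \<in> W \<Longrightarrow> p \<noteq> 0 \<Longrightarrow> pt p \<in> proj W"
  unfolding proj_def by blast

lemma is_line_iff: "is_line l \<longleftrightarrow> (\<exists>W. vec.subspace W \<and> vec.dim W = 2 \<and> l = proj W)"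
  unfolding is_line_def proj_def ..

lemma pt_in_proj:
  assumes "vec.subspace W" "v \<noteq> 0"
  shows "pt v \<in> proj W \<longleftrightarrow> v \<in> W"
proof
  assume "pt v \<in> proj W"
  then obtain w where "w \<in> W" "w \<noteq> 0" "pt v = pt w" by (rule proj_cases)
  then show "v \<in> W"
    using pt_eq_iff[of w v] assms by (auto intro: vec.subspace_scale)
qed (use assms pt_in_projI in blast)

section \<open>Pairs of lines with independent products\<close>

text \<open>The genericity condition on the two lines. It is symmetric in the two pairs (\<open>swap\<close>), so that
  each statement about the first line also yields the one about the second line.\<close>

locale segre_frame =
  fixes a b c d :: "('a::field)^4"
  assumes products_independent:
    "w *s (a * c) + x *s (a * d) + y *s (b * c) + z *s (b * d) = 0
      \<Longrightarrow> w = 0 \<and> x = 0 \<and> y = 0 \<and> z = 0"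
begin

lemma swap: "segre_frame c d a b"
proof
  fix w x y z assume "w *s (c * a) + x *s (c * b) + y *s (d * a) + z *s (d * b) = 0"
  then show "w = 0 \<and> x = 0 \<and> y = 0 \<and> z = 0"
    using products_independent[of w y x z] by (simp add: ac_simps)
qed

abbreviation "U \<equiv> vec.span {a, b}"
abbreviation "V \<equiv> vec.span {c, d}"
abbreviation "L \<equiv> proj U"
abbreviation "L' \<equiv> proj V"

definition comb :: "'a \<Rightarrow> 'a \<Rightarrow> 'a \<Rightarrow> 'a \<Rightarrow> 'a^4" where
  "comb w x y z = w *s (a * c) + x *s (a * d) + y *s (b * c) + z *s (b * d)"

lemma product_eq_comb:
  "(s *s a + t *s b) * (u *s c + v *s d) = comb (s * u) (s * v) (t * u) (t * v)"
  by (simp add: comb_def vec_eq_iff algebra_simps)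

lemma coordinates_exist:
  "\<exists>N :: 'a^4^4. (\<forall>x. N *v comb (x $ 1) (x $ 2) (x $ 3) (x $ 4) = x) \<and>
     (\<forall>v. comb ((N *v v) $ 1) ((N *v v) $ 2) ((N *v v) $ 3) ((N *v v) $ 4) = v)"
proof -
  define M :: "'a^4^4" where
    "M = (\<chi> i j. if j = 1 then (a * c) $ i else if j = 2 then (a * d) $ i
      else if j = 3 then (b * c) $ i else (b * d) $ i)"
  have M: "M *v x = comb (x $ 1) (x $ 2) (x $ 3) (x $ 4)" for x
    by (simp add: M_def comb_def vec_eq_iff matrix_vector_mult_def sum_4 algebra_simps)
  have "\<exists>N. N ** M = mat 1"
    unfolding matrix_left_invertible_ker M
  proof (intro allI impI)
    fix x :: "'a^4" assume "comb (x $ 1) (x $ 2) (x $ 3) (x $ 4) = 0"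
    from products_independent[OF this[unfolded comb_def]] show "x = 0"
      by (simp add: vec_eq_iff forall_4)
  qed
  then obtain N where N: "N ** M = mat 1" "M ** N = mat 1"
    using matrix_left_right_inverse by blast
  have "N *v (M *v x) = x" "M *v (N *v x) = x" for x
    using N by (simp_all add: matrix_vector_mul_assoc)
  then show ?thesis unfolding M by blast
qed

text \<open>The change of coordinates from the standard frame to the frame of products, that is, the
  inverse of the matrix whose columns are the products.\<close>

definition N :: "'a^4^4" where
  "N = (SOME N. (\<forall>x. N *v comb (x $ 1) (x $ 2) (x $ 3) (x $ 4) = x) \<and>
     (\<forall>v. comb ((N *v v) $ 1) ((N *v v) $ 2) ((N *v v) $ 3) ((N *v v) $ 4) = v))"

lemma N_inverse:
  "N *v comb (x $ 1) (x $ 2) (x $ 3) (x $ 4) = x"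
  "comb ((N *v v) $ 1) ((N *v v) $ 2) ((N *v v) $ 3) ((N *v v) $ 4) = v"
  using someI_ex[OF coordinates_exist, folded N_def] by blast+

definition coord :: "4 \<Rightarrow> 'a^4 \<Rightarrow> 'a" where
  "coord i v = (N *v v) $ i"

lemma coord_comb [simp]:
  "coord 1 (comb w x y z) = w" "coord 2 (comb w x y z) = x"
  "coord 3 (comb w x y z) = y" "coord 4 (comb w x y z) = z"
  using N_inverse(1)[of "\<chi> i. if i = 1 then w else if i = 2 then x else if i = 3 then y else z"]
  by (simp_all add: coord_def)

lemma comb_coord [simp]: "comb (coord 1 v) (coord 2 v) (coord 3 v) (coord 4 v) = v"
  using N_inverse(2) by (simp add: coord_def)

lemma comb_eq_iff:
  "comb w x y z = comb w' x' y' z' \<longleftrightarrow> w = w' \<and> x = x' \<and> y = y' \<and> z = z'"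
  by (metis coord_comb)

lemma comb_zero [simp]: "comb 0 0 0 0 = 0"
  by (simp add: comb_def)

lemma comb_eq_0_iff [simp]: "comb w x y z = 0 \<longleftrightarrow> w = 0 \<and> x = 0 \<and> y = 0 \<and> z = 0"
  using comb_eq_iff[of w x y z 0 0 0 0] by simp

lemma scale_comb: "k *s comb w x y z = comb (k * w) (k * x) (k * y) (k * z)"
  by (simp add: comb_def vec_eq_iff algebra_simps)

lemma coord_add: "coord i (v + w) = coord i v + coord i w"
  by (simp add: coord_def matrix_vector_right_distrib)

lemma coord_eq_sum: "coord i v = (\<Sum>j\<in>UNIV. N $ i $ j * v $ j)"
  by (simp add: coord_def matrix_vector_mult_def)

lemma poly_fun_coord: "poly_fun UNIV (\<lambda>x. \<Sum>j\<in>UNIV. N $ i $ j * x j)"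
  by (intro poly_fun_sum poly_fun.mult poly_fun.const poly_fun.var) auto

lemma product_nonzero: "p \<in> U \<Longrightarrow> q \<in> V \<Longrightarrow> p \<noteq> 0 \<Longrightarrow> q \<noteq> 0 \<Longrightarrow> p * q \<noteq> 0"
  by (auto simp: span_pair product_eq_comb)

lemma hmul_L:
  assumes "p \<in> U" "q \<in> V" "p \<noteq> 0" "q \<noteq> 0"
  shows "hmul (pt p) (pt q) = pt (p * q)"
  using assms product_nonzero hmul_pt by blast

text \<open>The product of \<open>(s, t)\<close> and \<open>(u, v)\<close> is the \<open>2 \<times> 2\<close> matrix of rank one with the entries
  \<open>su, sv, tu, tv\<close>, and a nonzero column of such a matrix recovers \<open>(s, t)\<close> up to a scalar.\<close>

lemma first_factor_unique:
  assumes "p \<in> U" "q \<in> V" "p \<noteq> 0" "q \<noteq> 0" "p' \<in> U" "q' \<in> V" "p' \<noteq> 0" "q' \<noteq> 0"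
    and "p' * q' = k *s (p * q)"
  shows "pt p = pt p'"
proof -
  obtain s t u v s' t' u' v' where
    pq: "p = s *s a + t *s b" "q = u *s c + v *s d" "p' = s' *s a + t' *s b" "q' = u' *s c + v' *s d"
    using assms by (auto simp: span_pair)
  have eqs: "s' * u' = k * (s * u)" "s' * v' = k * (s * v)" "t' * u' = k * (t * u)" "t' * v' = k * (t * v)"
    using assms(9) by (simp_all add: pq product_eq_comb scale_comb comb_eq_iff)
  have "\<exists>m. s' = m * s \<and> t' = m * t"
  proof (cases "u' = 0")
    case True
    then have "v' \<noteq> 0" using assms(8) pq by auto
    with eqs show ?thesis by (intro exI[of _ "k * v / v'"]) (simp add: field_simps)
  next
    case False
    with eqs show ?thesis by (intro exI[of _ "k * u / u'"]) (simp add: field_simps)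
  qed
  then obtain m where "s' = m * s" "t' = m * t" by blast
  then have m: "p' = m *s p"
    by (simp add: pq vector_add_ldistrib vector_smult_assoc)
  with assms(7) have "m \<noteq> 0" by auto
  with m show ?thesis using pt_scale assms(3) by metis
qed

lemma hmul_left_cancel:
  assumes "P \<in> L" "P' \<in> L" "Q \<in> L'" "Q' \<in> L'" "hmul P Q = hmul P' Q'"
  shows "P = P'"
proof -
  obtain p p' q q' where pq: "p \<in> U" "q \<in> V" "p \<noteq> 0" "q \<noteq> 0" "p' \<in> U" "q' \<in> V" "p' \<noteq> 0" "q' \<noteq> 0"
    "P = pt p" "P' = pt p'" "Q = pt q" "Q' = pt q'"
    using assms(1-4)[THEN proj_cases] by metis
  then have "pt (p * q) = pt (p' * q')" using assms(5) hmul_L by simp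
  then obtain k where "p' * q' = k *s (p * q)"
    using pt_eq_iff product_nonzero pq(1-8) by metis
  then show ?thesis using first_factor_unique pq by metis
qed

lemma hmul_inject:
  assumes "P \<in> L" "P' \<in> L" "Q \<in> L'" "Q' \<in> L'"
  shows "hmul P Q = hmul P' Q' \<longleftrightarrow> P = P' \<and> Q = Q'"
proof -
  interpret swap: segre_frame c d a b by (rule swap)
  show ?thesis
    using hmul_left_cancel swap.hmul_left_cancel assms by (metis hmul_commute)
qed

lemma hadamard_eq_hull:
  assumes "X \<subseteq> L" "Y \<subseteq> L'"
  shows "X \<star> Y = closed_p3 hull ((\<lambda>(P, Q). hmul P Q) ` (X \<times> Y))"
proof -
  have "{pt (p * q) | p q. p \<noteq> 0 \<and> q \<noteq> 0 \<and> pt p \<in> X \<and> pt q \<in> Y \<and> p * q \<noteq> 0}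
      = (\<lambda>(P, Q). hmul P Q) ` (X \<times> Y)" (is "?A = ?B")
  proof
    show "?A \<subseteq> ?B"
    proof
      fix R assume "R \<in> ?A"
      then obtain p q where "R = pt (p * q)" "p \<noteq> 0" "q \<noteq> 0" "pt p \<in> X" "pt q \<in> Y" "p * q \<noteq> 0"
        by blast
      then show "R \<in> ?B"
        by (intro image_eqI[of _ _ "(pt p, pt q)"]) (simp_all add: hmul_pt)
    qed
    show "?B \<subseteq> ?A"
    proof
      fix R assume "R \<in> ?B"
      then obtain P Q where PQ: "P \<in> X" "Q \<in> Y" "R = hmul P Q" by auto
      then have "P \<in> L" "Q \<in> L'" using assms by auto
      then obtain p q where "p \<in> U" "p \<noteq> 0" "P = pt p" "q \<in> V" "q \<noteq> 0" "Q = pt q"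
        by (metis proj_cases)
      with PQ show "R \<in> ?A"
        using hmul_L product_nonzero by blast
    qed
  qed
  then show ?thesis by (simp add: hadamard_def)
qed

subsection \<open>The quadric\<close>

text \<open>The determinant of the matrix of frame coordinates. It vanishes iff the matrix has rank at
  most one, that is, iff the vector is a product.\<close>

definition cone_form :: "'a^4 \<Rightarrow> 'a" where
  "cone_form x = coord 1 x * coord 4 x - coord 2 x * coord 3 x"

lemma cone_form_product: "p \<in> U \<Longrightarrow> q \<in> V \<Longrightarrow> cone_form (p * q) = 0"
  by (auto simp: span_pair cone_form_def product_eq_comb)

lemma cone_form_eq_0E:
  assumes "cone_form x = 0"
  obtains p q where "p \<in> U" "q \<in> V" "x = p * q"
proof -
  let ?z = "\<lambda>i. coord i x"
  have det: "?z 1 * ?z 4 = ?z 2 * ?z 3" using assms by (simp add: cone_form_def)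
  have "\<exists>s t u v. ?z 1 = s * u \<and> ?z 2 = s * v \<and> ?z 3 = t * u \<and> ?z 4 = t * v"
  proof (cases "?z 1 = 0 \<and> ?z 2 = 0")
    case True
    then show ?thesis by (intro exI[of _ 0] exI[of _ 1] exI[of _ "?z 3"] exI[of _ "?z 4"]) simp
  next
    case False
    show ?thesis
    proof (cases "?z 1 = 0")
      case True
      with False det show ?thesis
        by (intro exI[of _ 1] exI[of _ "?z 4 / ?z 2"] exI[of _ "?z 1"] exI[of _ "?z 2"]) auto
    next
      case z1: False
      with det show ?thesis
        by (intro exI[of _ 1] exI[of _ "?z 3 / ?z 1"] exI[of _ "?z 1"] exI[of _ "?z 2"])
          (auto simp: field_simps)
    qed
  qed
  then obtain s t u v where "?z 1 = s * u" "?z 2 = s * v" "?z 3 = t * u" "?z 4 = t * v" by blast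
  then have "x = (s *s a + t *s b) * (u *s c + v *s d)"
    using comb_coord[of x] by (simp add: product_eq_comb)
  with that show thesis by (metis span_pair)
qed

definition quadric :: "'a p3 set" where
  "quadric = {pt x | x. x \<noteq> 0 \<and> cone_form x = 0}"

lemma quadric_eq_products: "quadric = (\<lambda>(P, Q). hmul P Q) ` (L \<times> L')"
proof
  show "quadric \<subseteq> (\<lambda>(P, Q). hmul P Q) ` (L \<times> L')"
  proof
    fix R assume "R \<in> quadric"
    then obtain x where x: "R = pt x" "x \<noteq> 0" "cone_form x = 0" by (auto simp: quadric_def)
    then obtain p q where pq: "p \<in> U" "q \<in> V" "x = p * q" using cone_form_eq_0E by blast
    with x have "p \<noteq> 0" "q \<noteq> 0" by auto
    with x pq show "R \<in> (\<lambda>(P, Q). hmul P Q) ` (L \<times> L')"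
      by (intro image_eqI[of _ _ "(pt p, pt q)"]) (simp_all add: hmul_L pt_in_projI)
  qed
  show "(\<lambda>(P, Q). hmul P Q) ` (L \<times> L') \<subseteq> quadric"
  proof clarify
    fix P Q assume "P \<in> L" "Q \<in> L'"
    then obtain p q where "p \<in> U" "p \<noteq> 0" "P = pt p" "q \<in> V" "q \<noteq> 0" "Q = pt q"
      by (metis proj_cases)
    then show "hmul P Q \<in> quadric"
      unfolding quadric_def using hmul_L product_nonzero cone_form_product by blast
  qed
qed

definition quadric_matrix :: "'a^4^4" where
  "quadric_matrix = (\<chi> i j. N $ 1 $ i * N $ 4 $ j - N $ 2 $ i * N $ 3 $ j)"

lemma quad_form_eq_cone_form: "quad_form quadric_matrix x = cone_form x"
  by (simp add: quad_form_def quadric_matrix_def cone_form_def coord_eq_sum sum_product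
      sum_subtractf[symmetric] algebra_simps)

lemma pt_in_quadric: "x \<noteq> 0 \<Longrightarrow> pt x \<in> quadric \<longleftrightarrow> cone_form x = 0"
proof
  assume x: "x \<noteq> 0" and "pt x \<in> quadric"
  then obtain y where y: "y \<noteq> 0" "pt y = pt x" "cone_form y = 0" by (auto simp: quadric_def)
  then obtain k where "x = k *s y" using pt_eq_iff x by metis
  with y show "cone_form x = 0"
    by (simp add: cone_form_def coord_def matrix_vector_mult_scaleR vec.scale algebra_simps)
qed (auto simp: quadric_def)

lemma quadric_closed: "closed_p3 quadric"
proof (rule cut_out_closed)
  let ?z = "\<lambda>i x. \<Sum>j\<in>UNIV. N $ i $ j * x j"
  show "cut_out {\<lambda>x. ?z 1 x * ?z 4 x - ?z 2 x * ?z 3 x} quadric"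
    unfolding cut_out_def
    using pt_in_quadric
    by (auto intro!: poly_fun_diff poly_fun.mult poly_fun_coord simp: cone_form_def coord_eq_sum)
qed

text \<open>The gradient of the form at \<open>x\<close>, paired with \<open>y\<close>, is the polarization of the determinant at
  \<open>(x, y)\<close>. Letting \<open>y\<close> run through the frame reads off the coordinates of \<open>x\<close>, so a vanishing
  gradient forces \<open>x = 0\<close>, in every characteristic.\<close>

lemma nondegenerate: "nondegenerate_quadric quadric"
  unfolding nondegenerate_quadric_def
proof (intro exI[of _ quadric_matrix] conjI allI impI)
  have "cone_form (comb 1 0 0 1) \<noteq> 0" by (simp add: cone_form_def)
  then show "quadric_of quadric_matrix quadric"
    unfolding quadric_of_def quad_form_eq_cone_form quadric_def by blast
  fix x :: "'a^4" assume "x \<noteq> 0"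
  let ?D = "\<lambda>k. \<Sum>i\<in>UNIV. (quadric_matrix $ k $ i + quadric_matrix $ i $ k) * x $ i"
  have D: "?D k = N $ 1 $ k * coord 4 x + coord 1 x * N $ 4 $ k
      - N $ 2 $ k * coord 3 x - coord 2 x * N $ 3 $ k" for k
    by (simp add: quadric_matrix_def coord_eq_sum sum_distrib_left sum_distrib_right
        sum_subtractf[symmetric] sum.distrib[symmetric] algebra_simps)
  have pairing: "(\<Sum>k\<in>UNIV. ?D k * y $ k) = coord 1 y * coord 4 x + coord 1 x * coord 4 y
      - coord 2 y * coord 3 x - coord 2 x * coord 3 y" for y
    unfolding D
    by (simp add: coord_eq_sum[of _ y] sum_distrib_left sum_distrib_right
        sum_subtractf[symmetric] sum.distrib[symmetric] algebra_simps)
  show "\<exists>k. ?D k \<noteq> 0"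
  proof (rule ccontr)
    assume "\<not> (\<exists>k. ?D k \<noteq> 0)"
    then have 0: "coord 1 y * coord 4 x + coord 1 x * coord 4 y
      - coord 2 y * coord 3 x - coord 2 x * coord 3 y = 0" for y
      using pairing[of y] by simp
    have "coord 1 x = 0" "coord 2 x = 0" "coord 3 x = 0" "coord 4 x = 0"
      using 0[of "comb 0 0 0 1"] 0[of "comb 0 0 1 0"] 0[of "comb 0 1 0 0"] 0[of "comb 1 0 0 0"]
      by simp_all
    then have "x = 0" using comb_coord[of x] by simp
    with \<open>x \<noteq> 0\<close> show False ..
  qed
qed

subsection \<open>The rulings\<close>

definition ruling_line :: "'a p3 \<Rightarrow> 'a p3 set" where
  "ruling_line P = hmul P ` L'"

lemma product_plane:
  "x \<in> vec.span {p * c, p * d} \<longleftrightarrow> (\<exists>q\<in>V. x = p * q)"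
proof -
  have "u *s (p * c) + v *s (p * d) = p * (u *s c + v *s d)" for u v
    by (simp add: vec_eq_iff algebra_simps)
  then show ?thesis unfolding span_pair Bex_def by metis
qed

lemma ruling_line_eq_proj:
  assumes "p \<in> U" "p \<noteq> 0"
  shows "ruling_line (pt p) = proj (vec.span {p * c, p * d})"
proof -
  have "vec.span {p * c, p * d} - {0} = (\<lambda>q. p * q) ` (V - {0})"
  proof (intro set_eqI iffI)
    fix x assume "x \<in> vec.span {p * c, p * d} - {0}"
    then obtain q where "q \<in> V" "x = p * q" "x \<noteq> 0" using product_plane by blast
    then show "x \<in> (\<lambda>q. p * q) ` (V - {0})" by (cases "q = 0") auto
  next
    fix x assume "x \<in> (\<lambda>q. p * q) ` (V - {0})"
    then obtain q where q: "x = p * q" "q \<in> V - {0}" by (rule imageE)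
    then have "x \<in> vec.span {p * c, p * d}" using product_plane by blast
    moreover have "x \<noteq> 0" using q product_nonzero assms by simp
    ultimately show "x \<in> vec.span {p * c, p * d} - {0}" by simp
  qed
  then show ?thesis
    unfolding ruling_line_def proj_def using assms hmul_L by (force simp: image_image)
qed

lemma dim_product_plane:
  assumes "p \<in> U" "p \<noteq> 0"
  shows "vec.dim (vec.span {p * c, p * d}) = 2"
proof (rule dim_span_pair)
  fix u v assume *: "u *s (p * c) + v *s (p * d) = 0"
  obtain s t where p: "p = s *s a + t *s b" using assms by (auto simp: span_pair)
  have "u *s (p * c) + v *s (p * d) = p * (u *s c + v *s d)"
    by (simp add: vec_eq_iff algebra_simps)
  also have "\<dots> = comb (s * u) (s * v) (t * u) (t * v)"
    unfolding p by (rule product_eq_comb)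
  finally show "u = 0 \<and> v = 0" using * p assms(2) by auto
qed

lemma is_line_ruling_line:
  assumes "P \<in> L" shows "is_line (ruling_line P)"
proof -
  obtain p where "p \<in> U" "p \<noteq> 0" "P = pt p" using assms by (rule proj_cases)
  then show ?thesis
    unfolding is_line_iff using ruling_line_eq_proj dim_product_plane vec.subspace_span by metis
qed

text \<open>For \<open>p = s a + t b\<close>, a vector is a multiple of \<open>p\<close> by an element of \<open>V\<close> iff the two rows
  \<open>(z\<^sub>1, z\<^sub>2)\<close> and \<open>(z\<^sub>3, z\<^sub>4)\<close> of its coordinate matrix are in the ratio \<open>s : t\<close>.\<close>

lemma ruling_line_cut_out:
  assumes "P \<in> L" shows "\<exists>F. cut_out F (ruling_line P)"
proof -
  obtain p where p: "p \<in> U" "p \<noteq> 0" "P = pt p" using assms by (rule proj_cases)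
  obtain s t where st: "p = s *s a + t *s b" using p by (auto simp: span_pair)
  let ?z = "\<lambda>i x. \<Sum>j\<in>UNIV. N $ i $ j * x j"
  let ?F = "{\<lambda>x. t * ?z 1 x - s * ?z 3 x, \<lambda>x. t * ?z 2 x - s * ?z 4 x}"
  have "cut_out ?F (ruling_line P)"
    unfolding cut_out_def
  proof (intro conjI allI impI)
    show "\<forall>f\<in>?F. poly_fun UNIV f"
      by (auto intro!: poly_fun_diff poly_fun.mult poly_fun.const poly_fun_coord)
    fix x :: "'a^4" assume x: "x \<noteq> 0"
    have "pt x \<in> ruling_line P \<longleftrightarrow> (\<exists>q\<in>V. x = p * q)"
      using p x ruling_line_eq_proj pt_in_proj vec.subspace_span product_plane by metis
    also have "\<dots> \<longleftrightarrow> (\<exists>u v. x = comb (s * u) (s * v) (t * u) (t * v))"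
      unfolding st span_pair Bex_def by (metis product_eq_comb)
    also have "\<dots> \<longleftrightarrow> t * coord 1 x = s * coord 3 x \<and> t * coord 2 x = s * coord 4 x"
    proof
      assume *: "t * coord 1 x = s * coord 3 x \<and> t * coord 2 x = s * coord 4 x"
      have "\<exists>u v. coord 1 x = s * u \<and> coord 2 x = s * v \<and> coord 3 x = t * u \<and> coord 4 x = t * v"
      proof (cases "s = 0")
        case True
        with st p have "t \<noteq> 0" by auto
        with True * show ?thesis
          by (intro exI[of _ "coord 3 x / t"] exI[of _ "coord 4 x / t"]) auto
      next
        case False
        with * show ?thesis
          by (intro exI[of _ "coord 1 x / s"] exI[of _ "coord 2 x / s"]) (auto simp: field_simps)
      qed
      then show "\<exists>u v. x = comb (s * u) (s * v) (t * u) (t * v)" using comb_coord by metis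
    qed auto
    also have "\<dots> \<longleftrightarrow> (\<forall>f\<in>?F. f (($) x) = 0)" by (simp add: coord_eq_sum)
    finally show "pt x \<in> ruling_line P \<longleftrightarrow> (\<forall>f\<in>?F. f (($) x) = 0)" .
  qed
  then show ?thesis by blast
qed

lemma line_eq_ruling_line:
  assumes W: "vec.subspace W" "vec.dim W = 2" "W = vec.span {x, y}"
    and p: "p \<in> U" "p \<noteq> 0" and xy: "q \<in> V" "x = p * q" "q' \<in> V" "y = p * q'"
  shows "proj W = ruling_line (pt p)"
proof -
  have "W \<subseteq> vec.span {p * c, p * d}"
    unfolding W(3) by (rule vec.span_minimal) (use xy product_plane in \<open>auto simp: vec.subspace_span\<close>)
  then have "W = vec.span {p * c, p * d}"
    using vec.subspace_dim_equal[OF W(1) vec.subspace_span] dim_product_plane[OF p] W(2) by simp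
  then show ?thesis using ruling_line_eq_proj p by simp
qed

lemma proportional:
  assumes "s * t' = s' * (t::'a)" "s \<noteq> 0 \<or> t \<noteq> 0"
  shows "\<exists>k. s' = k * s \<and> t' = k * t"
proof (cases "s = 0")
  case True
  with assms show ?thesis by (intro exI[of _ "t' / t"]) auto
next
  case False
  with assms show ?thesis by (intro exI[of _ "s' / s"]) (auto simp: field_simps)
qed

text \<open>If the sum of the rank one matrices \<open>(s, t) (u, v)\<close> and \<open>(s', t') (u', v')\<close> is singular, then
  \<open>(s t' - s' t) (u v' - u' v) = 0\<close>, so the two matrices share their left or their right factor up
  to a scalar. Applied to a basis of a plane of singular matrices, this shows that the whole plane
  consists of multiples of that common factor.\<close>

lemma lines_in_quadric:
  assumes "is_line l" "l \<subseteq> quadric"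
  shows "(\<exists>P\<in>L. l = ruling_line P) \<or> (\<exists>Q\<in>L'. l = (\<lambda>P. hmul P Q) ` L)"
proof -
  interpret swap: segre_frame c d a b by (rule swap)
  obtain W where W: "vec.subspace W" "vec.dim W = 2" "l = proj W"
    using assms by (auto simp: is_line_iff)
  then have cone: "cone_form x = 0" if "x \<in> W" for x
    using that assms(2) pt_in_quadric[of x] pt_in_projI[of x W]
    by (cases "x = 0") (auto simp: cone_form_def coord_def)
  obtain B where B: "B \<subseteq> W" "vec.independent B" "vec.span B = W" "card B = 2"
    using vec.basis_subspace_exists[OF W(1)] W(2) by metis
  obtain x y where xy: "B = {x, y}" "x \<noteq> y" using B(4) by (auto simp: card_2_iff)
  have span: "W = vec.span {x, y}" using B(3) xy(1) by simp
  have nz: "x \<noteq> 0" "y \<noteq> 0" using B(2) xy vec.dependent_zero by auto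
  have "x \<in> W" "y \<in> W" "x + y \<in> W" using B xy W(1) by (auto intro: vec.subspace_add)
  then have c0: "cone_form x = 0" "cone_form y = 0" "cone_form (x + y) = 0" using cone by auto
  obtain p q where pq: "p \<in> U" "q \<in> V" "x = p * q" using c0(1) cone_form_eq_0E by blast
  obtain p' q' where pq': "p' \<in> U" "q' \<in> V" "y = p' * q'" using c0(2) cone_form_eq_0E by blast
  have nz': "p \<noteq> 0" "q \<noteq> 0" using nz pq by auto
  obtain s t u v s' t' u' v' where
    e: "p = s *s a + t *s b" "q = u *s c + v *s d" "p' = s' *s a + t' *s b" "q' = u' *s c + v' *s d"
    using pq pq' by (auto simp: span_pair)
  have "cone_form (x + y) = (s * t' - s' * t) * (u * v' - u' * v)"
    unfolding pq(3) pq'(3) e product_eq_comb cone_form_def coord_add coord_comb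
    by (simp add: algebra_simps)
  with c0(3) consider "s * t' = s' * t" | "u * v' = u' * v" by auto
  then show ?thesis
  proof cases
    case 1
    moreover have "s \<noteq> 0 \<or> t \<noteq> 0" using nz' e by auto
    ultimately obtain k where "s' = k * s" "t' = k * t" using proportional by blast
    then have "p' = k *s p" by (simp add: e vec_eq_iff algebra_simps)
    then have "y = p * (k *s q')" using pq'(3) by (simp add: vec_eq_iff)
    then have "proj W = ruling_line (pt p)"
      using line_eq_ruling_line[OF W(1,2) span pq(1) nz'(1) pq(2,3) vec.span_scale[OF pq'(2)]] by simp
    moreover have "pt p \<in> L" using pq(1) nz'(1) by (rule pt_in_projI)
    ultimately show ?thesis using W(3) by blast
  next
    case 2
    moreover have "u \<noteq> 0 \<or> v \<noteq> 0" using nz' e by auto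
    ultimately obtain k where "u' = k * u" "v' = k * v" using proportional by blast
    then have "q' = k *s q" by (simp add: e vec_eq_iff algebra_simps)
    then have "y = q * (k *s p')" "x = q * p" using pq'(3) pq(3) by (simp_all add: vec_eq_iff)
    then have "proj W = swap.ruling_line (pt q)"
      using swap.line_eq_ruling_line[OF W(1,2) span pq(2) nz'(2) pq(1) _ vec.span_scale[OF pq'(1)]]
      by simp
    also have "\<dots> = (\<lambda>P. hmul P (pt q)) ` L"
      unfolding swap.ruling_line_def by (simp add: hmul_commute)
    finally have "l = (\<lambda>P. hmul P (pt q)) ` L" using W(3) by simp
    moreover have "pt q \<in> L'" using pq(2) nz'(2) by (rule pt_in_projI)
    ultimately show ?thesis by blast
  qed
qed

subsection \<open>Hadamard products on the quadric\<close>

lemma hadamard_eq_UN: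
  assumes "finite X" "X \<subseteq> L"
  shows "X \<star> L' = (\<Union>P\<in>X. ruling_line P)"
proof -
  have "(\<lambda>(P, Q). hmul P Q) ` (X \<times> L') = (\<Union>P\<in>X. ruling_line P)"
    by (auto simp: ruling_line_def)
  moreover have "closed_p3 (\<Union>P\<in>X. ruling_line P)"
    using assms ruling_line_cut_out by (intro closed_finite_Union) blast+
  ultimately show ?thesis
    using hadamard_eq_hull[OF assms(2) subset_refl] by (simp add: hull_same)
qed

lemma hadamard_finite:
  assumes "finite X" "X \<subseteq> L" "finite Y" "Y \<subseteq> L'"
  shows "X \<star> Y = (\<lambda>(P, Q). hmul P Q) ` (X \<times> Y)"
proof -
  have "closed_p3 ((\<lambda>(P, Q). hmul P Q) ` (X \<times> Y))"
    using assms by (intro closed_finite finite_imageI finite_cartesian_product)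
  then show ?thesis using hadamard_eq_hull[OF assms(2,4)] by (simp only: hull_same)
qed

lemma hadamard_lines: "L \<star> L' = quadric"
  using hadamard_eq_hull[OF subset_refl subset_refl] quadric_closed
  by (simp add: hull_same quadric_eq_products)

lemma frame_vectors_nonzero: "a \<noteq> 0" "b \<noteq> 0" "c \<noteq> 0" "d \<noteq> 0"
  using products_independent[of 1 0 0 0] products_independent[of 0 0 0 1] by auto

lemma two_points: "\<exists>Q\<in>L'. \<exists>Q'\<in>L'. Q \<noteq> Q'"
proof -
  have "pt c \<noteq> pt d"
  proof
    assume "pt c = pt d"
    then obtain k where "d = k *s c" using pt_eq_iff frame_vectors_nonzero by metis
    then have "a * d = k *s (a * c)" by (simp add: vec_eq_iff)
    then show False using products_independent[of "-k" 1 0 0] by (simp add: vec_eq_iff)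
  qed
  moreover have "pt c \<in> L'" "pt d \<in> L'"
    using frame_vectors_nonzero by (simp_all add: pt_in_projI vec.span_base)
  ultimately show ?thesis by blast
qed

lemma in_ruling_line_iff:
  assumes "P \<in> L" "P' \<in> L" "Q \<in> L'"
  shows "hmul P Q \<in> ruling_line P' \<longleftrightarrow> P = P'"
proof
  assume "hmul P Q \<in> ruling_line P'"
  then obtain Q' where "hmul P Q = hmul P' Q'" "Q' \<in> L'" unfolding ruling_line_def by (rule imageE)
  with assms show "P = P'" using hmul_left_cancel by metis
next
  assume "P = P'"
  with assms(3) show "hmul P Q \<in> ruling_line P'" unfolding ruling_line_def by (simp only: imageI)
qed

lemma rulings_quadric:
  "rulings quadric (ruling_line ` L) ((\<lambda>Q. (\<lambda>P. hmul P Q) ` L) ` L')"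
proof -
  interpret swap: segre_frame c d a b by (rule swap)
  let ?R = "ruling_line ` L" and ?m = "\<lambda>Q. (\<lambda>P. hmul P Q) ` L"
  have m: "?m Q = swap.ruling_line Q" for Q
    unfolding swap.ruling_line_def by (simp add: hmul_commute)
  have in_m: "hmul P Q \<in> ?m Q' \<longleftrightarrow> Q = Q'" if "P \<in> L" "Q \<in> L'" "Q' \<in> L'" for P Q Q'
    using swap.in_ruling_line_iff[OF that(2,3,1)] unfolding m by (simp add: hmul_commute)
  have l_sub: "ruling_line P \<subseteq> quadric" if "P \<in> L" for P
    using that unfolding quadric_eq_products ruling_line_def by auto
  have m_sub: "?m Q \<subseteq> quadric" if "Q \<in> L'" for Q
    using that unfolding quadric_eq_products by auto
  show ?thesis
    unfolding rulings_def
  proof (intro conjI ballI impI)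
    show "?R \<union> ?m ` L' = {l. is_line l \<and> l \<subseteq> quadric}"
    proof (intro set_eqI iffI)
      fix l assume "l \<in> ?R \<union> ?m ` L'"
      then consider P where "P \<in> L" "l = ruling_line P" | Q where "Q \<in> L'" "l = ?m Q" by blast
      then show "l \<in> {l. is_line l \<and> l \<subseteq> quadric}"
        using l_sub m_sub is_line_ruling_line swap.is_line_ruling_line m by cases simp_all
    qed (use lines_in_quadric in blast)
    show "?R \<inter> ?m ` L' = {}"
    proof (rule ccontr)
      assume "?R \<inter> ?m ` L' \<noteq> {}"
      then obtain P Q where PQ: "P \<in> L" "Q \<in> L'" "ruling_line P = ?m Q" by blast
      obtain Q' where Q': "Q' \<in> L'" "Q' \<noteq> Q" using two_points by metis
      have "hmul P Q' \<in> ruling_line P" using PQ(1) Q' in_ruling_line_iff by blast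
      then show False using PQ Q' in_m by blast
    qed
  next
    fix X assume "X \<in> quadric"
    then obtain P Q where PQ: "P \<in> L" "Q \<in> L'" "X = hmul P Q" unfolding quadric_eq_products by auto
    show "\<exists>!l. l \<in> ?R \<and> X \<in> l"
      using PQ in_ruling_line_iff by (intro ex1I[of _ "ruling_line P"]) blast+
    show "\<exists>!l. l \<in> ?m ` L' \<and> X \<in> l"
      using PQ in_m by (intro ex1I[of _ "?m Q"]) blast+
  next
    fix l l' assume "l \<in> ?R" "l' \<in> ?R" "l \<noteq> l'"
    then obtain P P' where PP: "P \<in> L" "P' \<in> L" "l = ruling_line P" "l' = ruling_line P'" "P \<noteq> P'"
      by blast
    have "hmul P Q \<notin> l'" if "Q \<in> L'" for Q using in_ruling_line_iff PP that by blast
    then show "l \<inter> l' = {}" unfolding PP(3) ruling_line_def by blast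
  next
    fix l l' assume "l \<in> ?m ` L'" "l' \<in> ?m ` L'" "l \<noteq> l'"
    then obtain Q Q' where QQ: "Q \<in> L'" "Q' \<in> L'" "l = ?m Q" "l' = ?m Q'" "Q \<noteq> Q'"
      by blast
    have "hmul P Q \<notin> l'" if "P \<in> L" for P using in_m QQ that by blast
    then show "l \<inter> l' = {}" unfolding QQ(3) by blast
  next
    fix l m assume "l \<in> ?R" "m \<in> ?m ` L'"
    then obtain P Q where PQ: "P \<in> L" "Q \<in> L'" "l = ruling_line P" "m = ?m Q" by blast
    show "\<exists>!X. X \<in> l \<inter> m"
    proof (rule ex1I[of _ "hmul P Q"])
      show "hmul P Q \<in> l \<inter> m" using PQ in_ruling_line_iff in_m by blast
      fix X assume X: "X \<in> l \<inter> m"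
      then obtain Q' where "X = hmul P Q'" "Q' \<in> L'" using PQ(3) unfolding ruling_line_def by blast
      with X show "X = hmul P Q" using in_m PQ by blast
    qed
  qed
qed

text \<open>The quadric is parametrized by pairs of vectors. If \<open>f\<close> vanishes on \<open>A\<close> but not at \<open>p q\<close>, and
  \<open>g\<close> vanishes on \<open>B\<close> but not at \<open>p' q'\<close>, then on the segment-like curve \<open>r \<mapsto> P r * Q r\<close> from
  \<open>p q\<close> to \<open>p' q'\<close> both \<open>f\<close> and \<open>g\<close> are nonzero polynomials in \<open>r\<close>, and over an infinite field
  some \<open>r\<close> is a root of neither.\<close>

lemma irreducible:
  assumes "infinite (UNIV :: 'a set)"
  shows "irreducible_p3 quadric"
  unfolding irreducible_p3_def
proof (intro conjI allI impI)
  have "pt a \<in> L" "pt c \<in> L'" using frame_vectors_nonzero by (simp_all add: pt_in_projI vec.span_base)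
  then show "quadric \<noteq> {}" unfolding quadric_eq_products by blast
  have avoid: "\<exists>p q f. p \<in> U \<and> q \<in> V \<and> p * q \<noteq> 0 \<and> poly_fun UNIV f \<and> f (($) (p * q)) \<noteq> 0 \<and>
      (\<forall>v. v \<noteq> 0 \<longrightarrow> pt v \<in> A \<longrightarrow> f (($) v) = 0)"
    if A: "closed_p3 A" "\<not> quadric \<subseteq> A" for A
  proof -
    obtain F where F: "\<And>f. f \<in> F \<Longrightarrow> poly_fun UNIV f"
      "A = {p. \<forall>f\<in>F. \<forall>x\<in>point_coords p. f x = 0}"
      using A(1) unfolding zariski_closed_def by blast
    obtain X where X: "X \<in> quadric" "X \<notin> A" using A(2) by blast
    then obtain f x where fx: "f \<in> F" "x \<in> point_coords X" "f x \<noteq> 0" unfolding F(2) by blast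
    then obtain v where v: "x = ($) v" "v \<noteq> 0" "pt v = X" by (auto simp: point_coords_def)
    then have "cone_form v = 0" using X(1) pt_in_quadric by blast
    then obtain p q where pq: "p \<in> U" "q \<in> V" "v = p * q" by (rule cone_form_eq_0E)
    have "f (($) w) = 0" if "w \<noteq> 0" "pt w \<in> A" for w
      using that fx(1) unfolding F(2) point_coords_def by blast
    with pq v fx F(1) show ?thesis by blast
  qed
  fix A B assume AB: "closed_p3 A" "closed_p3 B" "quadric \<subseteq> A \<union> B"
  show "quadric \<subseteq> A \<or> quadric \<subseteq> B"
  proof (rule ccontr)
    assume "\<not> (quadric \<subseteq> A \<or> quadric \<subseteq> B)"
    then have nA: "\<not> quadric \<subseteq> A" and nB: "\<not> quadric \<subseteq> B" by auto
    obtain p q f where f: "p \<in> U" "q \<in> V" "p * q \<noteq> 0" "poly_fun UNIV f" "f (($) (p * q)) \<noteq> 0"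
      "\<And>v. v \<noteq> 0 \<Longrightarrow> pt v \<in> A \<Longrightarrow> f (($) v) = 0"
      using avoid[OF AB(1) nA] by blast
    obtain p' q' g where g: "p' \<in> U" "q' \<in> V" "p' * q' \<noteq> 0" "poly_fun UNIV g" "g (($) (p' * q')) \<noteq> 0"
      "\<And>v. v \<noteq> 0 \<Longrightarrow> pt v \<in> B \<Longrightarrow> g (($) v) = 0"
      using avoid[OF AB(2) nB] by blast
    define P where "P r = p + r *s (p' - p)" for r
    define Q where "Q r = q + r *s (q' - q)" for r
    have PQ: "P r \<in> U" "Q r \<in> V" for r
      unfolding P_def Q_def
      by (intro vec.span_add vec.span_scale vec.span_diff f(1,2) g(1,2))+
    have P01: "P 0 = p" "P 1 = p'" "Q 0 = q" "Q 1 = q'" by (simp_all add: P_def Q_def)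
    have coeff: "\<exists>h. \<forall>r. (P r * Q r) $ i = poly h r" for i
      by (intro exI[of _ "[:p $ i, p' $ i - p $ i:] * [:q $ i, q' $ i - q $ i:]"])
        (simp add: P_def Q_def algebra_simps)
    obtain F where F: "\<And>r. f (($) (P r * Q r)) = poly F r"
      using poly_fun_along_curve[OF f(4), of "\<lambda>r. ($) (P r * Q r)"] coeff by blast
    obtain G where G: "\<And>r. g (($) (P r * Q r)) = poly G r"
      using poly_fun_along_curve[OF g(4), of "\<lambda>r. ($) (P r * Q r)"] coeff by blast
    \<comment> \<open>A third polynomial, to avoid parameters where the product vector is zero and hence
      represents no point.\<close>
    obtain i where i: "(p * q) $ i \<noteq> 0" using f(3) unfolding vec_eq_iff by auto
    obtain H where H: "\<And>r. (P r * Q r) $ i = poly H r" using coeff by blast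
    have "poly F 0 \<noteq> 0" "poly G 1 \<noteq> 0" "poly H 0 \<noteq> 0"
      using F[of 0] G[of 1] H[of 0] f(5) g(5) i by (simp_all add: P01)
    then have "F * G * H \<noteq> 0" by auto
    then have "finite {r. poly (F * G * H) r = 0}" by (rule poly_roots_finite)
    then obtain r where "poly (F * G * H) r \<noteq> 0" using assms by (metis (full_types) UNIV_eq_I mem_Collect_eq)
    then have r: "f (($) (P r * Q r)) \<noteq> 0" "g (($) (P r * Q r)) \<noteq> 0" "(P r * Q r) $ i \<noteq> 0"
      unfolding F G H by simp_all
    then have nz: "P r * Q r \<noteq> 0" by (metis zero_index)
    then have "pt (P r * Q r) \<in> quadric"
      using PQ cone_form_product pt_in_quadric by blast
    then show False using AB(3) f(6)[OF nz] g(6)[OF nz] r by blast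
  qed
qed

lemma hadamard_grid:
  assumes X: "finite X" "X \<subseteq> L" and Y: "finite Y" "Y \<subseteq> L'"
  shows "X \<star> Y = (X \<star> L') \<inter> (Y \<star> L)" "card (X \<star> Y) = card X * card Y"
proof -
  interpret swap: segre_frame c d a b by (rule swap)
  have XY: "X \<star> Y = (\<lambda>(P, Q). hmul P Q) ` (X \<times> Y)"
    using hadamard_finite X Y by blast
  have XL: "X \<star> L' = (\<lambda>(P, Q). hmul P Q) ` (X \<times> L')"
    using hadamard_eq_UN[OF X] by (auto simp: ruling_line_def)
  have "Y \<star> L = (\<lambda>(Q, P). hmul Q P) ` (Y \<times> L)"
    using swap.hadamard_eq_UN[OF Y] by (auto simp: swap.ruling_line_def)
  then have YL: "Y \<star> L = (\<lambda>(P, Q). hmul P Q) ` (L \<times> Y)"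
    unfolding product_swap[of L Y, symmetric] image_image by (simp add: split_def hmul_commute)
  have inj: "inj_on (\<lambda>(P, Q). hmul P Q) (L \<times> L')"
    by (rule inj_onI) (use hmul_inject in auto)
  have "(X \<times> L') \<inter> (L \<times> Y) = X \<times> Y" using X Y by blast
  then show "X \<star> Y = (X \<star> L') \<inter> (Y \<star> L)"
    unfolding XY XL YL using inj_on_image_Int[OF inj, of "X \<times> L'" "L \<times> Y"] X Y
    by (simp only: Sigma_mono subset_refl)
  have "card (X \<star> Y) = card (X \<times> Y)"
    unfolding XY by (rule card_image, rule inj_on_subset[OF inj]) (use X Y in auto)
  then show "card (X \<star> Y) = card X * card Y" by (simp add: card_cartesian_product)
qed

lemma hadamard_rulings:
  "\<exists>R S. rulings (L \<star> L') R S \<and> (\<forall>P\<in>L. {P} \<star> L' \<in> R) \<and> (\<forall>Q\<in>L'. {Q} \<star> L \<in> S)"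
proof (intro exI conjI ballI)
  interpret swap: segre_frame c d a b by (rule swap)
  show "rulings (L \<star> L') (ruling_line ` L) ((\<lambda>Q. (\<lambda>P. hmul P Q) ` L) ` L')"
    unfolding hadamard_lines by (rule rulings_quadric)
  show "{P} \<star> L' \<in> ruling_line ` L" if "P \<in> L" for P
    using hadamard_eq_UN[of "{P}"] that by simp
  show "{Q} \<star> L \<in> (\<lambda>Q. (\<lambda>P. hmul P Q) ` L) ` L'" if "Q \<in> L'" for Q
    using swap.hadamard_eq_UN[of "{Q}"] that by (simp add: swap.ruling_line_def hmul_commute)
qed

lemma infinite_line:
  assumes "infinite (UNIV :: 'a set)" shows "infinite L"
proof -
  let ?f = "\<lambda>r. pt (a + r *s b)"
  have nz: "a + r *s b \<noteq> 0" for r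
  proof
    assume "a + r *s b = 0"
    then have "(1 *s a + r *s b) * (1 *s c + 0 *s d) = 0" by simp
    then show False unfolding product_eq_comb by simp
  qed
  have "inj ?f"
  proof (rule injI)
    fix r r' assume "?f r = ?f r'"
    then obtain k where k: "a + r' *s b = k *s (a + r *s b)" using pt_eq_iff nz by metis
    have "(1 *s a + r' *s b) * (1 *s c + 0 *s d) = k *s ((1 *s a + r *s b) * (1 *s c + 0 *s d))"
      by (simp add: k) (simp add: vec_eq_iff algebra_simps)
    then show "r = r'" unfolding product_eq_comb scale_comb comb_eq_iff by simp
  qed
  moreover have "range ?f \<subseteq> L"
  proof
    fix P assume "P \<in> range ?f"
    then obtain r where r: "P = ?f r" by blast
    have "a + r *s b \<in> U" by (intro vec.span_add vec.span_scale vec.span_base) auto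
    then show "P \<in> L" unfolding r using nz by (rule pt_in_projI)
  qed
  ultimately show ?thesis using assms finite_imageD finite_subset by blast
qed

end

section \<open>Genericity\<close>

text \<open>The exceptional set is defined by the constant \<open>1\<close> and is therefore empty, since every tuple
  of points has coordinates. The parameter space is nonempty because an infinite set contains
  \<open>n\<close> distinct points.\<close>

lemma generic_points_all:
  assumes inf: "infinite L" and all: "\<And>X. finite X \<Longrightarrow> X \<subseteq> L \<Longrightarrow> P X"
  shows "generic_points n L P"
proof -
  let ?T = "{xs. length xs = n \<and> distinct xs \<and> set xs \<subseteq> L}"
  let ?Z = "{xs :: 'a::field p3 list. \<forall>f\<in>{\<lambda>x. 1 :: 'a}. \<forall>x\<in>tuple_coords xs. f x = 0}"
  have "zariski_closed ({..<n} \<times> UNIV) tuple_coords ?Z"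
    unfolding zariski_closed_def by (intro exI[of _ "{\<lambda>x. 1 :: 'a}"]) (simp add: poly_fun.const)
  moreover have "xs \<notin> ?Z" for xs
  proof -
    have "(\<lambda>(i, k). rep_pt (xs ! i) $ k) \<in> tuple_coords xs"
      unfolding tuple_coords_def point_coords_def using rep_pt_nonzero pt_rep_pt by auto
    then show ?thesis by auto
  qed
  moreover have "\<exists>xs. xs \<in> ?T"
  proof -
    obtain B where B: "finite B" "card B = n" "B \<subseteq> L"
      using infinite_arbitrarily_large[OF inf] by blast
    obtain xs where "set xs = B" "distinct xs" using finite_distinct_list B(1) by blast
    then show ?thesis using B distinct_card[of xs] by (intro exI[of _ xs]) auto
  qed
  ultimately show ?thesis
    unfolding generic_points_def generically_def
    by (intro exI[of _ ?Z]) (use all in auto)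
qed

text \<open>Up to sign, the determinant of the four products in terms of the Pluecker coordinates of the
  two lines.\<close>

definition segre_poly :: "((4 \<times> 4) + (4 \<times> 4) \<Rightarrow> 'a::field) \<Rightarrow> 'a" where
  "segre_poly x = x (Inl (1, 2)) * x (Inl (3, 4)) * (x (Inr (1, 3)) * x (Inr (2, 4)))
     - x (Inl (1, 3)) * x (Inl (2, 4)) * (x (Inr (1, 2)) * x (Inr (3, 4)))"

lemma poly_fun_segre_poly: "poly_fun UNIV segre_poly"
  unfolding segre_poly_def by (intro poly_fun_diff poly_fun.mult poly_fun.var UNIV_I)

definition pluecker :: "('a::field)^4 \<Rightarrow> 'a^4 \<Rightarrow> 4 \<times> 4 \<Rightarrow> 'a" where
  "pluecker a b = (\<lambda>(i, j). a $ i * b $ j - a $ j * b $ i)"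

text \<open>Cramer's rule for the system whose \<open>i\<close>-th row is
  \<open>(a\<^sub>i c\<^sub>i, a\<^sub>i d\<^sub>i, b\<^sub>i c\<^sub>i, b\<^sub>i d\<^sub>i)\<close>: the equations are combined with the cofactors of the first
  column, which eliminates all unknowns except \<open>w\<close> and leaves its multiple by the determinant.\<close>

lemma cramer_segre:
  fixes a1 a2 a3 a4 b1 b2 b3 b4 c1 c2 c3 c4 d1 d2 d3 d4 w x y z :: "'a::field"
  assumes 1: "w * (a1 * c1) + x * (a1 * d1) + y * (b1 * c1) + z * (b1 * d1) = 0"
    and 2: "w * (a2 * c2) + x * (a2 * d2) + y * (b2 * c2) + z * (b2 * d2) = 0"
    and 3: "w * (a3 * c3) + x * (a3 * d3) + y * (b3 * c3) + z * (b3 * d3) = 0"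
    and 4: "w * (a4 * c4) + x * (a4 * d4) + y * (b4 * c4) + z * (b4 * d4) = 0"
  shows "w * ((a1 * b2 - a2 * b1) * (a3 * b4 - a4 * b3) * ((c1 * d3 - c3 * d1) * (c2 * d4 - c4 * d2))
    - (a1 * b3 - a3 * b1) * (a2 * b4 - a4 * b2) * ((c1 * d2 - c2 * d1) * (c3 * d4 - c4 * d3))) = 0"
proof -
  define M where "M e1 f1 g1 e2 f2 g2 e3 f3 g3
    = e1 * (f2 * g3 - f3 * g2) - f1 * (e2 * g3 - e3 * g2) + g1 * (e2 * f3 - e3 * f2)"
    for e1 f1 g1 e2 f2 g2 e3 f3 g3 :: 'a
  define C1 where "C1 = M (a2 * d2) (b2 * c2) (b2 * d2) (a3 * d3) (b3 * c3) (b3 * d3) (a4 * d4) (b4 * c4) (b4 * d4)"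
  define C2 where "C2 = M (a1 * d1) (b1 * c1) (b1 * d1) (a3 * d3) (b3 * c3) (b3 * d3) (a4 * d4) (b4 * c4) (b4 * d4)"
  define C3 where "C3 = M (a1 * d1) (b1 * c1) (b1 * d1) (a2 * d2) (b2 * c2) (b2 * d2) (a4 * d4) (b4 * c4) (b4 * d4)"
  define C4 where "C4 = M (a1 * d1) (b1 * c1) (b1 * d1) (a2 * d2) (b2 * c2) (b2 * d2) (a3 * d3) (b3 * c3) (b3 * d3)"
  define D where "D = (a1 * b2 - a2 * b1) * (a3 * b4 - a4 * b3) * ((c1 * d3 - c3 * d1) * (c2 * d4 - c4 * d2))
    - (a1 * b3 - a3 * b1) * (a2 * b4 - a4 * b2) * ((c1 * d2 - c2 * d1) * (c3 * d4 - c4 * d3))"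
  have det: "C1 * (a1 * c1) - C2 * (a2 * c2) + C3 * (a3 * c3) - C4 * (a4 * c4)
    = - D"
    unfolding D_def C1_def C2_def C3_def C4_def M_def by (simp add: algebra_simps)
  have x: "C1 * (a1 * d1) - C2 * (a2 * d2) + C3 * (a3 * d3) - C4 * (a4 * d4) = 0"
    unfolding C1_def C2_def C3_def C4_def M_def by (simp add: algebra_simps)
  have y: "C1 * (b1 * c1) - C2 * (b2 * c2) + C3 * (b3 * c3) - C4 * (b4 * c4) = 0"
    unfolding C1_def C2_def C3_def C4_def M_def by (simp add: algebra_simps)
  have z: "C1 * (b1 * d1) - C2 * (b2 * d2) + C3 * (b3 * d3) - C4 * (b4 * d4) = 0"
    unfolding C1_def C2_def C3_def C4_def M_def by (simp add: algebra_simps)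
  let ?E = "\<lambda>a b c d. w * (a * c) + x * (a * d) + y * (b * c) + z * (b * d)"
  have "0 = C1 * ?E a1 b1 c1 d1 - C2 * ?E a2 b2 c2 d2 + C3 * ?E a3 b3 c3 d3 - C4 * ?E a4 b4 c4 d4"
    unfolding assms by simp
  also have "\<dots> = w * (C1 * (a1 * c1) - C2 * (a2 * c2) + C3 * (a3 * c3) - C4 * (a4 * c4))
      + x * (C1 * (a1 * d1) - C2 * (a2 * d2) + C3 * (a3 * d3) - C4 * (a4 * d4))
      + y * (C1 * (b1 * c1) - C2 * (b2 * c2) + C3 * (b3 * c3) - C4 * (b4 * c4))
      + z * (C1 * (b1 * d1) - C2 * (b2 * d2) + C3 * (b3 * d3) - C4 * (b4 * d4))"
    by (simp add: algebra_simps)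
  finally have "w * D = 0" unfolding det x y z by simp
  then show ?thesis unfolding D_def .
qed

lemma first_coefficient_zero:
  assumes "segre_poly (case_sum (pluecker a b) (pluecker c d)) \<noteq> 0"
    and "w *s (a * c) + x *s (a * d) + y *s (b * c) + z *s (b * d) = 0"
  shows "w = 0"
proof -
  have "w * (a $ i * c $ i) + x * (a $ i * d $ i) + y * (b $ i * c $ i) + z * (b $ i * d $ i) = 0" for i
    using arg_cong[OF assms(2), of "\<lambda>v. v $ i"] by simp
  from cramer_segre[OF this[of 1] this[of 2] this[of 3] this[of 4]] assms(1) show ?thesis
    by (simp add: segre_poly_def pluecker_def)
qed

lemma pluecker_swap: "pluecker b a ij = - pluecker a b ij"
  by (simp add: pluecker_def split_def)

text \<open>Exchanging the vectors of one basis changes the sign of all Pluecker coordinates of that line,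
  and the polynomial has degree two in them. Hence it suffices to treat the first of the four
  coefficients of a linear relation: such exchanges move any other one to its place.\<close>

lemma segre_poly_swap:
  "segre_poly (case_sum (pluecker b a) q) = segre_poly (case_sum (pluecker a b) q)"
  "segre_poly (case_sum p (pluecker d c)) = segre_poly (case_sum p (pluecker c d))"
  by (simp_all add: segre_poly_def pluecker_swap[of b a] pluecker_swap[of d c])

lemma segre_frame_if_segre_poly:
  assumes "segre_poly (case_sum (pluecker a b) (pluecker c d)) \<noteq> 0"
  shows "segre_frame a b c d"
proof
  fix w x y z assume 0: "w *s (a * c) + x *s (a * d) + y *s (b * c) + z *s (b * d) = 0"
  have "w = 0" using first_coefficient_zero[OF assms 0] .
  moreover have "x = 0"
    using first_coefficient_zero[of a b d c x w z y] assms 0 by (simp add: segre_poly_swap ac_simps)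
  moreover have "y = 0"
    using first_coefficient_zero[of b a c d y z w x] assms 0 by (simp add: segre_poly_swap ac_simps)
  moreover have "z = 0"
    using first_coefficient_zero[of b a d c z y x w] assms 0 by (simp add: segre_poly_swap ac_simps)
  ultimately show "w = 0 \<and> x = 0 \<and> y = 0 \<and> z = 0" by blast
qed

lemma line_pair_coords_eq:
  "line_pair_coords (L, L') = {case_sum (pluecker a b) (pluecker c d) | a b c d.
     a \<noteq> b \<and> vec.independent {a, b} \<and> L = proj (vec.span {a, b}) \<and>
     c \<noteq> d \<and> vec.independent {c, d} \<and> L' = proj (vec.span {c, d})}"
  unfolding line_pair_coords_def pluecker_coords_def pluecker_def proj_def by auto

text \<open>Over any field, the lines spanned by \<open>(1, 0, 1, 0), (0, 1, 0, 1)\<close> and by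
  \<open>(1, 1, 0, 0), (0, 0, 1, 1)\<close> have the standard basis vectors as products.\<close>

lemma exists_segre_lines:
  "\<exists>L L' :: ('a::field) p3 set. is_line L \<and> is_line L' \<and> L \<noteq> L' \<and>
     (\<exists>x\<in>line_pair_coords (L, L'). segre_poly x \<noteq> 0)"
proof -
  define e :: "4 set \<Rightarrow> 'a^4" where "e I = (\<chi> i. if i \<in> I then 1 else 0)" for I
  define a b c d where abcd: "a = e {1, 3}" "b = e {2, 4}" "c = e {1, 2}" "d = e {3, 4}"
  have ab: "s = 0 \<and> t = 0" if "s *s a + t *s b = 0" for s t
    using arg_cong[OF that, of "\<lambda>v. v $ 1"] arg_cong[OF that, of "\<lambda>v. v $ 2"]
    by (simp add: abcd e_def)
  have cd: "s = 0 \<and> t = 0" if "s *s c + t *s d = 0" for s t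
    using arg_cong[OF that, of "\<lambda>v. v $ 1"] arg_cong[OF that, of "\<lambda>v. v $ 3"]
    by (simp add: abcd e_def)
  have ind: "a \<noteq> b" "vec.independent {a, b}" "c \<noteq> d" "vec.independent {c, d}"
    by (rule independent_pair, erule ab cd)+
  let ?L = "proj (vec.span {a, b})" and ?L' = "proj (vec.span {c, d})"
  have "is_line ?L" "is_line ?L'"
    unfolding is_line_iff using dim_span_pair[OF ab] dim_span_pair[OF cd] vec.subspace_span
    by blast+
  moreover have "?L \<noteq> ?L'"
  proof -
    have "a \<notin> vec.span {c, d}"
    proof
      assume "a \<in> vec.span {c, d}"
      then obtain s t where "a = s *s c + t *s d" unfolding span_pair by blast
      then have "a $ 1 = a $ 2" by (simp add: abcd e_def)
      then show False by (simp add: abcd e_def)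
    qed
    moreover have "a \<noteq> 0" using ab[of 1 0] by auto
    ultimately have "pt a \<in> ?L" "pt a \<notin> ?L'"
      by (simp_all add: pt_in_proj vec.subspace_span vec.span_base)
    then show ?thesis by blast
  qed
  moreover have "case_sum (pluecker a b) (pluecker c d) \<in> line_pair_coords (?L, ?L')"
    unfolding line_pair_coords_eq using ind by blast
  moreover have "segre_poly (case_sum (pluecker a b) (pluecker c d)) \<noteq> 0"
    by (simp add: segre_poly_def pluecker_def abcd e_def)
  ultimately show ?thesis by blast
qed

lemma generic_lines_if_segre_frame:
  assumes "\<And>a b c d :: ('a::field)^4. segre_frame a b c d \<Longrightarrow>
    P (proj (vec.span {a, b})) (proj (vec.span {c, d}))"
  shows "generic_distinct_lines P"
proof -
  let ?Z = "{p :: 'a p3 set \<times> 'a p3 set. \<forall>f\<in>{segre_poly}. \<forall>x\<in>line_pair_coords p. f x = 0}"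
  have "zariski_closed UNIV line_pair_coords ?Z"
    unfolding zariski_closed_def by (intro exI[of _ "{segre_poly}"]) (simp add: poly_fun_segre_poly)
  moreover have "\<not> {(L, L'). is_line L \<and> is_line L' \<and> L \<noteq> L'} \<subseteq> ?Z"
    using exists_segre_lines by blast
  moreover have "P L L'" if "(L, L') \<notin> ?Z" for L L'
  proof -
    obtain x where "x \<in> line_pair_coords (L, L')" "segre_poly x \<noteq> 0" using \<open>(L, L') \<notin> ?Z\<close> by blast
    then obtain a b c d where "segre_poly (case_sum (pluecker a b) (pluecker c d)) \<noteq> 0"
      "L = proj (vec.span {a, b})" "L' = proj (vec.span {c, d})"
      unfolding line_pair_coords_eq by blast
    then show ?thesis using assms segre_frame_if_segre_poly by blast
  qed
  ultimately show ?thesis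
    unfolding generic_distinct_lines_def generically_def by (intro exI[of _ ?Z]) auto
qed

lemma infinite_alg_closed: "infinite (UNIV :: 'a::alg_closed_field set)"
proof
  assume fin: "finite (UNIV :: 'a set)"
  \<comment> \<open>As in Euclid's proof: this polynomial takes the value \<open>1\<close> everywhere.\<close>
  let ?p = "(\<Prod>r\<in>(UNIV :: 'a set). [:- r, 1:]) + 1"
  have "degree (\<Prod>r\<in>(UNIV :: 'a set). [:- r, 1:]) = card (UNIV :: 'a set)"
    by (subst degree_prod_eq_sum_degree) auto
  then have "degree (\<Prod>r\<in>(UNIV :: 'a set). [:- r, 1:]) > 0"
    using fin by (simp add: card_gt_0_iff)
  then have "degree ?p > 0" by (simp add: degree_add_eq_left)
  then obtain r where "poly ?p r = 0" using alg_closed_imp_poly_has_root by blast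
  moreover have "poly ?p r = 1" using fin by (simp add: poly_prod prod_zero_iff)
  ultimately show False by simp
qed

theorem corollary4p5:
  shows "generic_distinct_lines (\<lambda>L L' :: ('a::alg_closed_field) p3 set.
    \<forall>n\<ge>2. generic_points n L (\<lambda>X.
      \<forall>m\<ge>2. generic_points m L' (\<lambda>X'.
        X \<star> X' = (X \<star> L') \<inter> (X' \<star> L) \<and>
        card (X \<star> X') = card X * card X' \<and>
        irreducible_p3 (L \<star> L') \<and> nondegenerate_quadric (L \<star> L') \<and>
        (\<exists>R S. rulings (L \<star> L') R S \<and>
           (\<forall>P\<in>X. {P} \<star> L' \<in> R) \<and> (\<forall>P'\<in>X'. {P'} \<star> L \<in> S)))))"
proof (rule generic_lines_if_segre_frame)
  fix a b c d :: "'a^4"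
  assume "segre_frame a b c d"
  then interpret segre_frame a b c d .
  interpret swap: segre_frame c d a b by (rule swap)
  obtain R S where RS: "rulings (L \<star> L') R S" "\<forall>P\<in>L. {P} \<star> L' \<in> R" "\<forall>Q\<in>L'. {Q} \<star> L \<in> S"
    using hadamard_rulings by blast
  show "\<forall>n\<ge>2. generic_points n L (\<lambda>X.
      \<forall>m\<ge>2. generic_points m L' (\<lambda>X'.
        X \<star> X' = (X \<star> L') \<inter> (X' \<star> L) \<and>
        card (X \<star> X') = card X * card X' \<and>
        irreducible_p3 (L \<star> L') \<and> nondegenerate_quadric (L \<star> L') \<and>
        (\<exists>R S. rulings (L \<star> L') R S \<and>
           (\<forall>P\<in>X. {P} \<star> L' \<in> R) \<and> (\<forall>P'\<in>X'. {P'} \<star> L \<in> S))))"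
  proof (intro allI impI generic_points_all infinite_line swap.infinite_line infinite_alg_closed conjI)
    fix X X' assume XX: "finite X" "X \<subseteq> L" "finite X'" "X' \<subseteq> L'"
    show "X \<star> X' = (X \<star> L') \<inter> (X' \<star> L)" "card (X \<star> X') = card X * card X'"
      using hadamard_grid XX by blast+
    show "irreducible_p3 (L \<star> L')" "nondegenerate_quadric (L \<star> L')"
      unfolding hadamard_lines using irreducible infinite_alg_closed nondegenerate by blast+
    show "\<exists>R S. rulings (L \<star> L') R S \<and>
        (\<forall>P\<in>X. {P} \<star> L' \<in> R) \<and> (\<forall>P'\<in>X'. {P'} \<star> L \<in> S)"
      using RS XX by blast
  qed
qed

end
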